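(* Let $r_0$ denote the unique real root of the equation $4r^3+r-2=0$. Then for all $f\in H^\infty_1(\mathbb{D})$ and all $N\in\mathbb{N}$, $$\sup_{z\in\mathbb{T}}\left|(S_N(f))(r_0z)\right|\leq \|f\|_\infty.$$ Moreover, the constant $r_0$ cannot be replaced by a larger number; that is, for every real $r>r_0$ there exist $f\in H^\infty_1(\mathbb{D})$ and $N\in\mathbb{N}$ such that $\sup_{z\in\mathbb{T}}|(S_N(f))(rz)|>\|f\|_\infty$.
   Context: $\mathbb{D}$ is the open unit disc in $\mathbb{C}$ and $\mathbb{T}=\partial\mathbb{D}$ is the unit circle; $\mathbb{N}=\{1,2,3,\dots\}$. $H^\infty(\mathbb{D})$ is the Banach algebra of bounded (scalar-valued) analytic functions on $\mathbb{D}$ with norm $\|f\|_\infty=\sup_{z\in\mathbb{D}}|f(z)|$. The Neil algebra is $H^\infty_1(\mathbb{D})=\{f\in H^\infty(\mathbb{D}): f'(0)=0\}$. For an analytic function $f(z)=\sum_{n=0}^\infty a_nz^n$ on $\mathbb{D}$ and $N\in\mathbb{N}$, the $N$-th partial sum is the polynomial $(S_N(f))(z)=\sum_{n=0}^N a_nz^n$. *)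

theory Defs
  imports "HOL-Complex_Analysis.Complex_Analysis"
begin

text \<open>Functions on the disc are total functions on the complex plane; only their values
  on the open unit disc matter in the definitions below.\<close>

definition H_inf :: "(complex \<Rightarrow> complex) set" where
  "H_inf = {f. f holomorphic_on ball 0 1 \<and> bounded (f ` ball 0 1)}"

definition H_inf_norm :: "(complex \<Rightarrow> complex) \<Rightarrow> real" where
  "H_inf_norm f = (SUP z\<in>ball 0 1. cmod (f z))"

definition neil_algebra :: "(complex \<Rightarrow> complex) set" where
  "neil_algebra = {f \<in> H_inf. deriv f 0 = 0}"

definition partial_sum :: "nat \<Rightarrow> (complex \<Rightarrow> complex) \<Rightarrow> complex \<Rightarrow> complex" where
  "partial_sum N f z = (\<Sum>n\<le>N. fps_nth (fps_expansion f 0) n * z ^ n)"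

text \<open>The coefficients in \<^const>\<open>partial_sum\<close> are those of the power series of \<open>f\<close>.\<close>

lemma H_inf_power_series:
  assumes "f \<in> H_inf" "cmod z < 1"
  shows "(\<lambda>n. fps_nth (fps_expansion f 0) n * z ^ n) sums f z"
  using holomorphic_power_series[of f 0 1 z] assms
  by (simp add: H_inf_def fps_expansion_def)

definition r0 :: real where
  "r0 = (THE r. 4 * r ^ 3 + r - 2 = 0)"

end

theory Submission
  imports Defs
begin

text \<open>If a cosine polynomial \<open>1 + 2 (\<Sum>k=1..N. c k * cos (k * t))\<close> is nonnegative, then integrating
  \<open>f\<close> against it on circles of radius less than 1 bounds \<open>a 0 + (\<Sum>k=1..N. c k * a k)\<close> by
  the norm of \<open>f\<close>. Membership in the Neil algebra leaves \<open>c 1\<close> free, so the bound holds at radius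
  \<open>r\<close> once some choice of \<open>c 1\<close> makes the polynomial with \<open>c k = r ^ k\<close> for \<open>k \<ge> 2\<close> nonnegative.
  For \<open>N = 3\<close> the best choice gives a polynomial in \<open>cos t\<close> with roots \<open>-1\<close> and \<open>x0 > 0\<close>, and
  \<open>4 * r ^ 3 + r - 2 = 0\<close> says that \<open>x0\<close> is a double root; all other \<open>N\<close> leave room at \<open>r0\<close>.

  Conversely, the measure with atoms at \<open>-1\<close> and at the two points with real part \<open>x0\<close>, with vanishing
  first moment, annihilates the extremal polynomial. Its Herglotz transform \<open>g\<close> has positive real part
  but, beyond \<open>r0\<close>, a negative third partial sum; \<open>1 - \<epsilon> * g (s * w)\<close> with \<open>s < 1\<close> and small \<open>\<epsilon>\<close>
  then violates the bound.\<close>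

section \<open>Taylor coefficients as integrals over the unit circle\<close>

lemma coeff_integral:
  fixes g :: "complex \<Rightarrow> complex" and k :: nat
  assumes "g holomorphic_on ball 0 R" "R > 1"
  shows "((\<lambda>t. g (cis t) / cis t ^ k) has_integral 2 * pi * fps_nth (fps_expansion g 0) k) {0..2 * pi}"
proof -
  have "g holomorphic_on cball 0 1" "g holomorphic_on ball 0 1"
    using assms by (auto elim!: holomorphic_on_subset)
  then have "((\<lambda>u. g u / (u - 0) ^ Suc k) has_contour_integral
          2 * pi * \<i> / fact k * (deriv ^^ k) g 0) (circlepath 0 1)"
    by (intro Cauchy_has_contour_integral_higher_derivative_circlepath)
       (simp_all add: holomorphic_on_imp_continuous_on)
  then have "((\<lambda>t. g (cis t) / cis t ^ Suc k * \<i> * cis t) has_integral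
          2 * pi * \<i> / fact k * (deriv ^^ k) g 0) {0..2 * pi}"
    by (simp add: circlepath_def has_contour_integral_part_circlepath_iff)
  note has_integral_mult_left[OF this, of "-\<i>"]
  also have "(\<lambda>t. g (cis t) / cis t ^ Suc k * \<i> * cis t * (-\<i>)) = (\<lambda>t. g (cis t) / cis t ^ k)"
    by (simp add: fun_eq_iff mult.assoc)
  also have "2 * pi * \<i> / fact k * (deriv ^^ k) g 0 * (-\<i>) = 2 * pi * fps_nth (fps_expansion g 0) k"
    by (simp add: fps_expansion_def mult_ac)
  finally show ?thesis .
qed

text \<open>Cauchy's theorem for \<open>g u * u ^ (k - 1)\<close>: the derivative of the
  parametrisation supplies the missing factor \<open>cis t\<close>, and \<open>k \<ge> 1\<close>
  excludes a pole at the origin.\<close>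

lemma negative_coeff_integral:
  fixes g :: "complex \<Rightarrow> complex" and k :: nat
  assumes "g holomorphic_on ball 0 R" "R > 1" "k \<ge> 1"
  shows "((\<lambda>t. g (cis t) * cis t ^ k) has_integral 0) {0..2 * pi}"
proof -
  have "((\<lambda>u. g u * u ^ (k - 1)) has_contour_integral 0) (circlepath 0 1)"
    by (rule Cauchy_theorem_disc_simple[where a = 0 and e = R])
       (use assms in \<open>auto intro!: holomorphic_intros\<close>)
  then have "((\<lambda>t. g (cis t) * cis t ^ (k - 1) * \<i> * cis t) has_integral 0) {0..2 * pi}"
    by (simp add: circlepath_def has_contour_integral_part_circlepath_iff)
  note has_integral_mult_left[OF this, of "-\<i>"]
  also have "(\<lambda>t. g (cis t) * cis t ^ (k - 1) * \<i> * cis t * (-\<i>)) = (\<lambda>t. g (cis t) * cis t ^ k)"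
  proof
    fix t :: real
    have "cis t ^ k = cis t ^ (k - 1) * cis t"
      using assms(3) by (metis power_minus_mult less_eq_Suc_le One_nat_def)
    then show "g (cis t) * cis t ^ (k - 1) * \<i> * cis t * (-\<i>) = g (cis t) * cis t ^ k"
      by (simp add: mult_ac)
  qed
  finally show ?thesis by simp
qed

lemma cos_multiple_integral:
  fixes g :: "complex \<Rightarrow> complex" and k :: nat
  assumes "g holomorphic_on ball 0 R" "R > 1" "k \<ge> 1"
  shows "((\<lambda>t. g (cis t) * of_real (2 * cos (k * t))) has_integral
           2 * pi * fps_nth (fps_expansion g 0) k) {0..2 * pi}"
proof -
  have "g (cis t) / cis t ^ k + g (cis t) * cis t ^ k = g (cis t) * of_real (2 * cos (k * t))" for t :: real
  proof -
    have "inverse (cis t ^ k) + cis t ^ k = of_real (2 * cos (k * t))"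
      by (simp add: Complex.DeMoivre complex_eq_iff)
    then show ?thesis
      by (simp add: divide_inverse flip: distrib_left)
  qed
  with has_integral_add[OF coeff_integral[OF assms(1,2), of k] negative_coeff_integral[OF assms]]
  show ?thesis by simp
qed

text \<open>The normalisation makes the mean value 1 and turns \<open>c k\<close> into the exact
  weight of the \<open>k\<close>-th Taylor coefficient.\<close>

definition cos_poly :: "nat \<Rightarrow> (nat \<Rightarrow> real) \<Rightarrow> real \<Rightarrow> real" where
  "cos_poly N c t = 1 + (\<Sum>k=1..N. c k * (2 * cos (k * t)))"

lemma cos_poly_integral:
  fixes g :: "complex \<Rightarrow> complex"
  assumes "g holomorphic_on ball 0 R" "R > 1"
  shows "((\<lambda>t. g (cis t) * of_real (cos_poly N c t)) has_integral
           2 * pi * (fps_nth (fps_expansion g 0) 0 +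
             (\<Sum>k=1..N. c k * fps_nth (fps_expansion g 0) k))) {0..2 * pi}"
proof -
  have "((\<lambda>t. g (cis t) + (\<Sum>k=1..N. g (cis t) * of_real (2 * cos (k * t)) * c k)) has_integral
      2 * pi * fps_nth (fps_expansion g 0) 0 +
        (\<Sum>k=1..N. 2 * pi * fps_nth (fps_expansion g 0) k * c k)) {0..2 * pi}"
    using assms
    by (intro has_integral_add has_integral_sum has_integral_mult_left cos_multiple_integral)
       (use coeff_integral[OF assms, of 0] in auto)
  then show ?thesis
    by (simp add: cos_poly_def sum_distrib_left distrib_left mult_ac)
qed

text \<open>When nonnegative, \<open>cos_poly N c t / (2 * pi)\<close> is a probability density on
  \<open>{0..2 * pi}\<close>, and the sum is the mean of \<open>g (cis t)\<close> with respect to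
  it.\<close>

lemma nonneg_cos_poly_bound:
  fixes g :: "complex \<Rightarrow> complex"
  assumes "g holomorphic_on ball 0 R" "R > 1"
    and nonneg: "\<And>t. cos_poly N c t \<ge> 0"
    and M: "\<And>w. cmod w = 1 \<Longrightarrow> cmod (g w) \<le> M"
  shows "cmod (fps_nth (fps_expansion g 0) 0 +
           (\<Sum>k=1..N. c k * fps_nth (fps_expansion g 0) k)) \<le> M"
    (is "cmod ?S \<le> M")
proof -
  have 1: "((\<lambda>t. g (cis t) * of_real (cos_poly N c t)) has_integral 2 * pi * ?S) {0..2 * pi}"
    by (rule cos_poly_integral) fact+
  \<comment> \<open>The integral formula applied to the constant function 1 yields the total
    mass.\<close>
  have coeff: "fps_expansion (\<lambda>_. 1) 0 = (1 :: complex fps)"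
    by (rule fps_expansion_eqI) auto
  have "((\<lambda>t. Re (1 * of_real (cos_poly N c t))) has_integral Re (2 * pi)) {0..2 * pi}"
    using cos_poly_integral[of "\<lambda>_. 1" 2 N c] unfolding coeff
    by (intro has_integral_Re) (simp add: sum.neutral)
  then have 2: "((\<lambda>t. M * cos_poly N c t) has_integral M * (2 * pi)) {0..2 * pi}"
    by (intro has_integral_mult_right) simp
  have "norm (integral {0..2 * pi} (\<lambda>t. g (cis t) * of_real (cos_poly N c t)))
      \<le> integral {0..2 * pi} (\<lambda>t. M * cos_poly N c t)"
    using nonneg M by (intro integral_norm_bound_integral has_integral_integrable[OF 1]
      has_integral_integrable[OF 2]) (simp add: norm_mult mult_right_mono)
  then show ?thesis
    unfolding integral_unique[OF 1] integral_unique[OF 2] by (simp add: norm_mult)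
qed

section \<open>From circle averages to partial sums\<close>

lemma fps_expansion_scaled:
  fixes f :: "complex \<Rightarrow> complex"
  assumes f: "f holomorphic_on ball 0 1" and u: "0 < cmod u"
  shows "(\<lambda>w. f (u * w)) holomorphic_on ball 0 (1 / cmod u)"
    and "fps_nth (fps_expansion (\<lambda>w. f (u * w)) 0) k = u ^ k * fps_nth (fps_expansion f 0) k"
proof -
  have sub: "u * w \<in> ball 0 1" if "w \<in> ball 0 (1 / cmod u)" for w
    using that u by (simp add: norm_mult field_simps)
  have "f \<circ> (\<lambda>w. u * w) holomorphic_on ball 0 (1 / cmod u)"
    by (rule holomorphic_on_compose_gen[OF _ f]) (use sub in \<open>auto intro!: holomorphic_intros\<close>)
  then show "(\<lambda>w. f (u * w)) holomorphic_on ball 0 (1 / cmod u)"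
    by (simp add: o_def)
  have "(deriv ^^ k) (\<lambda>w. f (u * w)) 0 = u ^ k * (deriv ^^ k) f (u * 0)"
    by (rule higher_deriv_compose_linear[OF f, of "ball 0 (1 / cmod u)"]) (use sub u in auto)
  then show "fps_nth (fps_expansion (\<lambda>w. f (u * w)) 0) k = u ^ k * fps_nth (fps_expansion f 0) k"
    by (simp add: fps_expansion_def)
qed

lemma cmod_le_H_inf_norm:
  assumes "f \<in> H_inf" "cmod z < 1"
  shows "cmod (f z) \<le> H_inf_norm f"
  unfolding H_inf_norm_def
proof (rule cSUP_upper)
  show "bdd_above ((\<lambda>z. cmod (f z)) ` ball 0 1)"
    using assms(1) by (auto simp: H_inf_def bounded_iff bdd_above_def)
qed (use assms in auto)

text \<open>The coefficient \<open>a 1\<close> vanishes, so its weight \<open>c\<close> is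
  arbitrary; the remaining weights \<open>r ^ k\<close> reproduce the partial sum.\<close>

lemma partial_sum_bound:
  assumes f: "f \<in> neil_algebra" and z: "cmod z = 1"
    and nonneg: "\<And>t. cos_poly N (\<lambda>k. if k = 1 then c else r ^ k) t \<ge> 0"
  shows "cmod (partial_sum N f (of_real r * z)) \<le> H_inf_norm f"
proof -
  define a where "a = fps_nth (fps_expansion f 0)"
  have f': "f \<in> H_inf" "f holomorphic_on ball 0 1" "a 1 = 0"
    using f by (auto simp: neil_algebra_def H_inf_def a_def fps_expansion_def)
  \<comment> \<open>The function \<open>f\<close> is controlled only on the open disc, so the
    average is taken on the circle of radius \<open>\<rho> < 1\<close>; the partial sum is a
    polynomial, which allows \<open>\<rho>\<close> to tend to 1 afterwards.\<close>
  have "cmod (partial_sum N f (of_real (\<rho> * r) * z)) \<le> H_inf_norm f" if \<rho>: "0 < \<rho>" "\<rho> < 1" for \<rho> :: real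
  proof -
    define u where "u = of_real \<rho> * z"
    have u: "cmod u = \<rho>" using \<rho> z by (simp add: u_def norm_mult)
    have "cmod (fps_nth (fps_expansion (\<lambda>w. f (u * w)) 0) 0 +
        (\<Sum>k=1..N. of_real (if k = 1 then c else r ^ k) *
          fps_nth (fps_expansion (\<lambda>w. f (u * w)) 0) k)) \<le> H_inf_norm f"
      by (rule nonneg_cos_poly_bound[OF fps_expansion_scaled(1)[OF f'(2)] _ nonneg])
         (use u \<rho> in \<open>auto intro!: cmod_le_H_inf_norm f'(1) simp: norm_mult\<close>)
    also have "fps_nth (fps_expansion (\<lambda>w. f (u * w)) 0) = (\<lambda>k. u ^ k * a k)"
      by (rule ext, unfold a_def, rule fps_expansion_scaled(2)[OF f'(2)]) (use u \<rho> in simp)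
    also have "u ^ 0 * a 0 + (\<Sum>k=1..N. of_real (if k = 1 then c else r ^ k) * (u ^ k * a k))
        = a 0 + (\<Sum>k=1..N. a k * (of_real (\<rho> * r) * z) ^ k)"
      by (rule arg_cong2[of _ _ _ _ "(+)"], simp, rule sum.cong)
         (use f'(3) in \<open>auto simp: u_def power_mult_distrib\<close>)
    also have "\<dots> = partial_sum N f (of_real (\<rho> * r) * z)"
      by (simp add: partial_sum_def a_def atMost_atLeast0 sum.atLeast_Suc_atMost)
    finally show ?thesis .
  qed
  then have "eventually (\<lambda>\<rho>::real. cmod (partial_sum N f (of_real (\<rho> * r) * z)) \<le> H_inf_norm f) (at_left 1)"
    by (auto simp: eventually_at_left_field intro!: exI[of _ 0])
  moreover have "((\<lambda>\<rho>::real. cmod (partial_sum N f (of_real (\<rho> * r) * z))) \<longlongrightarrow>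
      cmod (partial_sum N f (of_real (1 * r) * z))) (at_left 1)"
    unfolding partial_sum_def by (intro tendsto_intros)
  ultimately show ?thesis
    using tendsto_upperbound by fastforce
qed

section \<open>Nonnegative cosine polynomials for each degree\<close>

lemma cos_poly_1_nonneg: "cos_poly 1 (\<lambda>k. if k = 1 then 0 else r ^ k) t \<ge> 0"
  by (simp add: cos_poly_def)

lemma cos_poly_2_nonneg:
  assumes "r\<^sup>2 \<le> 1 / 2"
  shows "cos_poly 2 (\<lambda>k. if k = 1 then 0 else r ^ k) t \<ge> 0"
proof -
  have "cos_poly 2 (\<lambda>k. if k = 1 then 0 else r ^ k) t = 1 - 2 * r\<^sup>2 + 4 * r\<^sup>2 * (cos t)\<^sup>2"
    using cos_double_cos[of t]
    by (simp add: cos_poly_def numeral_2_eq_2) (simp add: algebra_simps power2_eq_square)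
  then show ?thesis using assms by simp
qed

text \<open>The coefficient of \<open>cos t\<close> is dictated by the factorization
  \<open>8 * r ^ 3 * (1 + x) * (x - x0)\<^sup>2\<close> in \<open>x = cos t\<close>.\<close>

lemma cos_poly_3_nonneg:
  assumes "4 * r ^ 3 + r - 2 = 0" "r > 0"
  defines "x0 \<equiv> (2 * r - 1) / (4 * r)"
  shows "cos_poly 3 (\<lambda>k. if k = 1 then 4 * r ^ 3 * (x0\<^sup>2 - 2 * x0) + 3 * r ^ 3 else r ^ k) t \<ge> 0"
proof -
  define x where "x = cos t"
  have r4: "4 * r * x0 = 2 * r - 1" using assms by (simp add: x0_def)
  have r3: "4 * r ^ 3 = 2 - r" using assms by simp
  \<comment> \<open>Matching the constant terms of the two sides of the factorization requires
    \<open>x02\<close>, and this is where the cubic equation enters. The quadratic terms match by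
    \<open>x01\<close>, which only uses the definition of \<open>x0\<close>.\<close>
  have "8 * r ^ 3 * x0\<^sup>2 = (r * (2 * r - 1)\<^sup>2) / 2"
    by (simp add: r4[symmetric] power2_eq_square power3_eq_cube)
  also have "\<dots> = (4 * r ^ 3 - 4 * r\<^sup>2 + r) / 2"
    by (simp add: power2_eq_square power3_eq_cube algebra_simps)
  finally have x02: "8 * r ^ 3 * x0\<^sup>2 = 1 - 2 * r\<^sup>2"
    using r3 by simp
  have x01: "16 * r ^ 3 * x0 = 4 * r\<^sup>2 * (2 * r - 1)"
    by (simp add: r4[symmetric] power2_eq_square power3_eq_cube)
  have "cos_poly 3 (\<lambda>k. if k = 1 then 4 * r ^ 3 * (x0\<^sup>2 - 2 * x0) + 3 * r ^ 3 else r ^ k) t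
      = 1 + (8 * r ^ 3 * x0\<^sup>2 - 16 * r ^ 3 * x0 + 6 * r ^ 3) * x + 2 * r\<^sup>2 * (2 * x\<^sup>2 - 1)
          + 2 * r ^ 3 * (4 * x ^ 3 - 3 * x)"
    by (simp add: cos_poly_def cos_double_cos cos_treble_cos numeral_3_eq_3 numeral_2_eq_2 x_def)
       (simp add: algebra_simps)
  also have "\<dots> = (1 + x) * (8 * r ^ 3 * x0\<^sup>2 - 16 * r ^ 3 * x0 * x + 8 * r ^ 3 * x\<^sup>2)"
    unfolding x01 x02 by (simp add: power2_eq_square power3_eq_cube algebra_simps)
  also have "\<dots> = 8 * r ^ 3 * (1 + x) * (x - x0)\<^sup>2"
    by (simp add: power2_eq_square algebra_simps)
  also have "\<dots> \<ge> 0"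
  proof -
    have "0 \<le> 1 + x" using cos_ge_minus_one[of t] unfolding x_def by linarith
    then show ?thesis using assms(2) by simp
  qed
  finally show ?thesis .
qed

lemma cos_poly_4_nonneg:
  assumes "r\<^sup>2 \<le> 1 / 2" "r > 0"
  shows "cos_poly 4 (\<lambda>k. if k = 1 then 8 / 5 * r ^ 3 else r ^ k) t \<ge> 0"
proof -
  define x where "x = cos t"
  have cos4: "cos (4 * t) = 8 * x ^ 4 - 8 * x\<^sup>2 + 1"
  proof -
    have "cos (4 * t) = 2 * (cos (2 * t))\<^sup>2 - 1"
      using cos_double_cos[of "2 * t"] by simp
    also have "cos (2 * t) = 2 * x\<^sup>2 - 1"
      using cos_double_cos[of t] by (simp add: x_def)
    finally show ?thesis
      by (simp add: power2_eq_square power4_eq_xxxx algebra_simps)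
  qed
  have "cos_poly 4 (\<lambda>k. if k = 1 then 8 / 5 * r ^ 3 else r ^ k) t
      = 1 + 16 / 5 * r ^ 3 * x + 2 * r\<^sup>2 * cos (2 * t) + 2 * r ^ 3 * cos (3 * t) + 2 * r ^ 4 * cos (4 * t)"
    by (simp add: cos_poly_def x_def numeral_eq_Suc)
  \<comment> \<open>Completing the square: the terms in \<open>x ^ 4\<close> and
    \<open>x ^ 3\<close> force \<open>4 * r\<^sup>2 * x\<^sup>2 + r * x\<close>, and the weight
    \<open>8 / 5 * r ^ 3\<close> makes the linear term fit the constant
    \<open>- 7 / 5 * r\<^sup>2\<close>. For \<open>r\<^sup>2 \<le> 1 / 2\<close> both remainders are
    nonnegative.\<close>
  also have "\<dots> = (4 * r\<^sup>2 * x\<^sup>2 + r * x - 7 / 5 * r\<^sup>2)\<^sup>2 + r\<^sup>2 * (3 - 24 / 5 * r\<^sup>2) * x\<^sup>2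
      + (1 - 2 * r\<^sup>2 + r ^ 4 / 25)"
    by (simp add: cos4 cos_double_cos cos_treble_cos flip: x_def)
       (simp add: power2_eq_square power3_eq_cube power4_eq_xxxx algebra_simps)
  also have "\<dots> \<ge> 0"
    using assms by (intro add_nonneg_nonneg mult_nonneg_nonneg) auto
  finally show ?thesis .
qed

text \<open>With \<open>z = rcis r t\<close> the polynomial is the real part of
  \<open>(1 + z - 2 * z ^ Suc N) / (1 - z)\<close>. Multiplied by the squared modulus of
  \<open>1 - z\<close>, this is \<open>1 - r\<^sup>2\<close>, as for the Poisson kernel, minus a
  tail of size at most \<open>2 * r ^ Suc N * (1 + r)\<close>. At \<open>r0\<close> the hypothesis
  just fails for \<open>N = 4\<close>, hence the separate treatment of that degree.\<close>

lemma cos_poly_geometric_nonneg: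
  assumes "0 < r" "r < 1" "2 * r ^ Suc N \<le> 1 - r"
  shows "cos_poly N (\<lambda>k. r ^ k) t \<ge> 0"
proof -
  define z where "z = rcis r t"
  have z: "cmod z = r" using assms by (simp add: z_def)
  then have z1: "z \<noteq> 1" using assms by auto
  have Re_z: "Re (z ^ k) = r ^ k * cos (k * t)" for k
    by (simp add: z_def DeMoivre2)
  define S where "S = (\<Sum>k\<le>N. z ^ k)"
  have S: "S * (1 - z) = 1 - z ^ Suc N"
    unfolding S_def using z1 by (simp add: lessThan_Suc_atMost[symmetric] geometric_sum field_simps)
  have "cos_poly N (\<lambda>k. r ^ k) t = 1 + 2 * (\<Sum>k=1..N. Re (z ^ k))"
    by (simp add: cos_poly_def Re_z sum_distrib_left mult_ac)
  also have "\<dots> = Re (2 * S - 1)"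
    unfolding S_def by (simp add: atMost_atLeast0 sum.atLeast_Suc_atMost)
  finally have eq: "cos_poly N (\<lambda>k. r ^ k) t = Re (2 * S - 1)" .
  have "cmod (1 - cnj z) \<le> 1 + r"
    using norm_triangle_ineq4[of 1 "cnj z"] z by simp
  then have "r ^ Suc N * cmod (1 - cnj z) \<le> r ^ Suc N * (1 + r)"
    using assms by (intro mult_left_mono) auto
  then have "2 * Re (z ^ Suc N * (1 - cnj z)) \<le> 2 * r ^ Suc N * (1 + r)"
    using complex_Re_le_cmod[of "z ^ Suc N * (1 - cnj z)"] z by (simp add: norm_mult norm_power)
  also have "\<dots> \<le> (1 - r) * (1 + r)"
    using assms by (intro mult_right_mono) auto
  finally have "0 \<le> (1 - r) * (1 + r) - 2 * Re (z ^ Suc N * (1 - cnj z))" by simp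
  also have "\<dots> = Re ((1 + z - 2 * z ^ Suc N) * cnj (1 - z))"
  proof -
    have "Re (z * cnj z) = r\<^sup>2" using z by (simp add: complex_mult_cnj cmod_power2[symmetric])
    then show ?thesis by (simp add: algebra_simps power2_eq_square del: power_Suc)
  qed
  also have "(1 + z - 2 * z ^ Suc N) = (2 * S - 1) * (1 - z)"
  proof -
    have "z ^ Suc N = 1 - S * (1 - z)" using S by simp
    then show ?thesis by (simp only:) (simp add: algebra_simps)
  qed
  also have "(2 * S - 1) * (1 - z) * cnj (1 - z) = (2 * S - 1) * of_real ((cmod (1 - z))\<^sup>2)"
    by (simp add: complex_norm_square[symmetric] mult.assoc del: complex_cnj_diff)
  also have "Re \<dots> = Re (2 * S - 1) * (cmod (1 - z))\<^sup>2"
    by simp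
  finally show ?thesis
    using z1 unfolding eq by (simp add: zero_le_mult_iff)
qed

section \<open>Location of \<open>r0\<close> and the choice of the free weight\<close>

lemma ex1_r0: "\<exists>!r::real. 4 * r ^ 3 + r - 2 = 0"
proof (rule ex_ex1I)
  show "\<exists>r::real. 4 * r ^ 3 + r - 2 = 0"
    using IVT[of "\<lambda>r::real. 4 * r ^ 3 + r - 2" 0 0 1] by (auto intro!: continuous_intros)
next
  fix r s :: real
  assume *: "4 * r ^ 3 + r - 2 = 0" "4 * s ^ 3 + s - 2 = 0"
  have "r ^ 3 \<le> s ^ 3" if "r \<le> s" for r s :: real
    using that by (rule power_mono_odd[rotated]) simp
  from this[of r s] this[of s r] * show "r = s" by linarith
qed

lemma r0_root: "4 * r0 ^ 3 + r0 - 2 = 0"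
  unfolding r0_def by (rule theI') (rule ex1_r0)

text \<open>The lower bound makes the double root \<open>x0\<close> positive; the upper bound is
  sharp enough for \<open>r0\<^sup>2 \<le> 1 / 2\<close> and for the geometric case from
  \<open>N = 5\<close> on.\<close>

lemma r0_bounds: "1 / 2 < r0" "r0 < 69 / 100"
proof -
  have *: "r ^ 3 \<le> s ^ 3" if "r \<le> s" for r s :: real
    using that by (rule power_mono_odd[rotated]) simp
  show "1 / 2 < r0"
    using *[of r0 "1/2"] r0_root by (cases "1 / 2 < r0") (auto simp: power3_eq_cube)
  show "r0 < 69 / 100"
    using *[of "69 / 100" r0] r0_root by (cases "r0 < 69 / 100") (auto simp: power3_eq_cube)
qed

lemma ex_cos_poly_r0_nonneg:
  assumes "N \<ge> 1"
  shows "\<exists>c. \<forall>t. cos_poly N (\<lambda>k. if k = 1 then c else r0 ^ k) t \<ge> 0"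
proof -
  note b = r0_bounds
  have pos: "r0 > 0" using b by simp
  have sq: "r0\<^sup>2 \<le> 1 / 2"
    using power_mono[of r0 "69 / 100" 2] b by (simp add: power2_eq_square)
  consider "N = 1" | "N = 2" | "N = 3" | "N = 4" | "N \<ge> 5" using assms by linarith
  then show ?thesis
  proof cases
    case 5
    \<comment> \<open>The target \<open>31 / 200\<close> is half of
      \<open>1 - 69 / 100\<close>.\<close>
    have "r0 ^ Suc N \<le> r0 ^ 6" using 5 b by (intro power_decreasing) auto
    also have "\<dots> \<le> (69 / 100) ^ 6" using b by (intro power_mono) auto
    also have "\<dots> \<le> 31 / 200" by (simp add: power_divide)
    finally have "2 * r0 ^ Suc N \<le> 1 - r0" using b by simp
    with cos_poly_geometric_nonneg[of r0 N] b
    have "\<forall>t. cos_poly N (\<lambda>k. r0 ^ k) t \<ge> 0" by simp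
    moreover have "(\<lambda>k. r0 ^ k) = (\<lambda>k. if k = 1 then r0 else r0 ^ k)" by auto
    ultimately show ?thesis by metis
  qed (use cos_poly_1_nonneg cos_poly_2_nonneg[OF sq] cos_poly_3_nonneg[OF r0_root pos]
        cos_poly_4_nonneg[OF sq pos] in blast)+
qed


section \<open>Optimality of \<open>r0\<close>\<close>

text \<open>The Herglotz kernel: for \<open>cmod v = 1\<close>, \<open>cayley (v * w)\<close> is the
  Herglotz transform of the unit mass at \<open>cnj v\<close>.\<close>

definition cayley :: "complex \<Rightarrow> complex" where
  "cayley u = (1 + u) / (1 - u)"

lemma Re_cayley_pos:
  assumes "cmod u < 1"
  shows "Re (cayley u) > 0"
proof -
  have u: "u \<noteq> 1" using assms by auto
  have "(cmod u)\<^sup>2 < 1\<^sup>2" using assms by (intro power_strict_mono) auto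
  then have "(Re u)\<^sup>2 + (Im u)\<^sup>2 < 1" by (simp add: cmod_power2)
  then have "0 < Re ((1 + u) * cnj (1 - u))"
    by (simp add: algebra_simps power2_eq_square)
  moreover have "cayley u = (1 + u) * cnj (1 - u) / of_real ((cmod (1 - u))\<^sup>2)"
    unfolding cayley_def complex_norm_square using u by (simp del: complex_cnj_diff)
  ultimately show ?thesis
    using u by (simp add: Re_divide_of_real del: of_real_power complex_cnj_diff)
qed

lemma cayley_sums:
  assumes "cmod (v * w) < 1"
  shows "(\<lambda>n. (if n = 0 then 1 else 2 * v ^ n) * w ^ n) sums cayley (v * w)"
proof -
  have ne: "v * w \<noteq> 1" using assms by auto
  have "(\<lambda>n. 2 * (v * w) ^ n) sums (2 * (1 / (1 - v * w)))"
    using assms by (intro sums_mult geometric_sums)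
  from sums_diff[OF this sums_single[of 0 "\<lambda>_. 1"]]
  have "(\<lambda>n. 2 * (v * w) ^ n - (if n = 0 then 1 else 0)) sums (2 * (1 / (1 - v * w)) - 1)"
    by simp
  also have "2 * (1 / (1 - v * w)) - 1 = cayley (v * w)"
    using ne by (simp add: cayley_def field_simps)
  also have "(\<lambda>n. 2 * (v * w) ^ n - (if n = 0 then 1 else 0))
      = (\<lambda>n. (if n = 0 then 1 else 2 * v ^ n) * w ^ n)"
    by (auto simp: fun_eq_iff power_mult_distrib)
  finally show ?thesis .
qed

lemma fps_nth_expansion_eqI:
  fixes f :: "complex \<Rightarrow> complex"
  assumes "\<And>w. cmod w < 1 \<Longrightarrow> (\<lambda>n. a n * w ^ n) sums f w"
  shows "fps_nth (fps_expansion f 0) = a"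
proof -
  have "eventually (\<lambda>w. w \<in> ball 0 1) (nhds (0 :: complex))"
    by (intro eventually_nhds_in_open) auto
  then have "f has_fps_expansion Abs_fps a"
    by (intro has_fps_expansionI) (auto elim!: eventually_mono intro: assms)
  then show ?thesis
    by (simp add: fps_expansion_eqI fun_eq_iff)
qed

text \<open>The hypothesis \<open>neg\<close> says that the third partial sum of the transform
  \<open>g\<close> at \<open>r\<close>, divided by the total mass \<open>1 + x0\<close>, is
  negative. Subtracting a small multiple of \<open>g\<close> from 1 then pushes the partial sum
  above 1, while positivity of the real part of \<open>g\<close> keeps the function itself in the
  closed unit disc.\<close>

lemma ex_partial_sum_3_large:
  assumes x0: "0 < x0" "x0 < 1" and s: "0 < s" "s < 1"
    and neg: "1 - 2 * (s * r)\<^sup>2 * (1 - 2 * x0) - 8 * (s * r) ^ 3 * x0 * (1 - x0) < 0"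
  shows "\<exists>f\<in>neil_algebra. (SUP z\<in>sphere 0 1. cmod (partial_sum 3 f (of_real r * z))) > H_inf_norm f"
proof -
  define \<zeta> where "\<zeta> = cis (arccos x0)"
  define \<zeta>' where "\<zeta>' = cis (- arccos x0)"
  define e where "e = (\<lambda>v n. if n = 0 then 1 else 2 * v ^ n :: complex)"
  \<comment> \<open>The masses are \<open>x0\<close> at -1 and 1/2 at each of the conjugate points
    with real part \<open>x0\<close>, so the first moment is \<open>- x0 + x0 = 0\<close>; this
    yields \<open>b 1 = 0\<close>.\<close>
  define g where "g = (\<lambda>w :: complex. x0 * cayley (- s * w) + (cayley (\<zeta> * s * w) + cayley (\<zeta>' * s * w)) / 2)"
  define b where "b = (\<lambda>n. x0 * e (- s) n + (e (\<zeta> * s) n + e (\<zeta>' * s) n) / 2)"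
  have small: "cmod (- s * w) < 1" "cmod (\<zeta> * s * w) < 1" "cmod (\<zeta>' * s * w) < 1"
    if "cmod w \<le> 1" for w :: complex
    using that s mult_strict_mono'[of s 1 "cmod w" 1] mult_le_cancel_left1[of s "cmod w"]
    by (auto simp: norm_mult \<zeta>_def \<zeta>'_def intro: le_less_trans[of _ s])
  have g_sums: "(\<lambda>n. b n * w ^ n) sums g w" if "cmod w < 1" for w :: complex
  proof -
    have "(\<lambda>n. x0 * (e (- s) n * w ^ n) + (e (\<zeta> * s) n * w ^ n + e (\<zeta>' * s) n * w ^ n) / 2) sums g w"
      unfolding g_def e_def using small[of w] that
      by (intro sums_add sums_mult sums_divide cayley_sums) auto
    then show ?thesis
      by (simp add: b_def algebra_simps add_divide_distrib)
  qed
  have cayley_hol: "(\<lambda>w. cayley (v * w)) holomorphic_on cball 0 1"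
    if "\<And>w. cmod w \<le> 1 \<Longrightarrow> cmod (v * w) < 1" for v
  proof -
    have "1 - v * w \<noteq> 0" if "w \<in> cball 0 1" for w
      using \<open>cmod w \<le> 1 \<Longrightarrow> cmod (v * w) < 1\<close> that by auto
    then show ?thesis
      unfolding cayley_def by (intro holomorphic_intros)
  qed
  have g_hol: "g holomorphic_on cball 0 1"
    unfolding g_def by (intro holomorphic_intros cayley_hol small) auto
  have g_cont: "continuous_on (cball 0 1) g"
    using g_hol by (rule holomorphic_on_imp_continuous_on)
  \<comment> \<open>Since \<open>s < 1\<close>, \<open>g\<close> is continuous on the closed disc,
    and compactness turns pointwise positivity of its real part into a uniform bound
    \<open>\<delta>\<close>.\<close>
  have "\<exists>w0\<in>cball 0 1. \<forall>w\<in>cball 0 1. Re (g w0) \<le> Re (g w)"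
    by (intro continuous_attains_inf continuous_on_Re g_cont) auto
  then obtain w0 where w0: "cmod w0 \<le> 1" "\<And>w. cmod w \<le> 1 \<Longrightarrow> Re (g w0) \<le> Re (g w)"
    by auto
  define \<delta> where "\<delta> = Re (g w0)"
  have Re_g: "\<delta> \<le> Re (g w)" if "cmod w < 1" for w
    using w0(2)[of w] that by (simp add: \<delta>_def)
  have \<delta>: "\<delta> > 0"
    using Re_cayley_pos[OF small(1)[OF w0(1)]] Re_cayley_pos[OF small(2)[OF w0(1)]]
      Re_cayley_pos[OF small(3)[OF w0(1)]] x0
    by (simp add: \<delta>_def g_def add_pos_pos)
  have "bounded (g ` cball 0 1)"
    using compact_continuous_image[OF g_cont compact_cball] by (rule compact_imp_bounded)
  then obtain B where "B > 0" "\<forall>y\<in>g ` cball 0 1. cmod y \<le> B"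
    unfolding bounded_pos by blast
  then have B: "B > 0" "\<And>w. cmod w \<le> 1 \<Longrightarrow> cmod (g w) \<le> B"
    by simp_all
  \<comment> \<open>With this choice the quadratic term
    \<open>\<epsilon>\<^sup>2 * B\<^sup>2\<close> is only half of the gain
    \<open>2 * \<epsilon> * \<delta>\<close> in the squared modulus of
    \<open>1 - \<epsilon> * g w\<close>.\<close>
  define \<epsilon> where "\<epsilon> = \<delta> / B\<^sup>2"
  have \<epsilon>: "\<epsilon> > 0" using \<delta> B by (simp add: \<epsilon>_def)
  define f where "f = (\<lambda>w. 1 - \<epsilon> * g w)"
  have f_le: "cmod (f w) \<le> 1" if "cmod w < 1" for w
  proof -
    have "(cmod (f w))\<^sup>2 = 1 - 2 * \<epsilon> * Re (g w) + \<epsilon>\<^sup>2 * (cmod (g w))\<^sup>2"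
      by (simp add: f_def cmod_power2) (simp add: power2_eq_square algebra_simps)
    also have "\<dots> \<le> 1 - 2 * \<epsilon> * \<delta> + \<epsilon>\<^sup>2 * B\<^sup>2"
      using Re_g[OF that] B(2)[of w] that \<epsilon>
      by (intro add_mono diff_mono mult_left_mono power_mono) auto
    also have "\<epsilon>\<^sup>2 * B\<^sup>2 = \<epsilon> * \<delta>"
      using B by (simp add: \<epsilon>_def power2_eq_square)
    finally have "(cmod (f w))\<^sup>2 \<le> 1\<^sup>2"
      using mult_pos_pos[OF \<epsilon> \<delta>] by (simp add: mult.commute)
    then show ?thesis
      by (rule power2_le_imp_le) simp
  qed
  have f_coeff: "fps_nth (fps_expansion f 0) = (\<lambda>n. (if n = 0 then 1 else 0) - \<epsilon> * b n)"
  proof (rule fps_nth_expansion_eqI)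
    fix w :: complex assume "cmod w < 1"
    from sums_diff[OF sums_single[of 0 "\<lambda>_. 1"] sums_mult[OF g_sums[OF this], of \<epsilon>]]
    have "(\<lambda>n. (if n = 0 then 1 else 0) - \<epsilon> * (b n * w ^ n)) sums f w"
      by (simp add: f_def)
    also have "(\<lambda>n. (if n = 0 then 1 else 0) - \<epsilon> * (b n * w ^ n))
        = (\<lambda>n. ((if n = 0 then 1 else 0) - \<epsilon> * b n) * w ^ n)"
      by (auto simp: fun_eq_iff algebra_simps)
    finally show "(\<lambda>n. ((if n = 0 then 1 else 0) - \<epsilon> * b n) * w ^ n) sums f w" .
  qed
  have cos_th: "cos (arccos x0) = x0" using x0 by simp
  have b0: "b 0 = 1 + x0" by (simp add: b_def e_def)
  have b_Suc: "b n = of_real (2 * s ^ n * (x0 * (-1) ^ n + cos (n * arccos x0)))" if "n > 0" for n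
  proof -
    have "\<zeta> ^ n + \<zeta>' ^ n = of_real (2 * cos (n * arccos x0))"
      by (simp add: \<zeta>_def \<zeta>'_def Complex.DeMoivre complex_eq_iff)
    moreover have "b n = x0 * (2 * (- s) ^ n) + s ^ n * (\<zeta> ^ n + \<zeta>' ^ n)"
      using that by (simp add: b_def e_def power_mult_distrib algebra_simps add_divide_distrib)
    ultimately show ?thesis
      by (simp add: power_minus[of s] power_minus[of "of_real s"] algebra_simps)
  qed
  have b1: "b 1 = 0" using b_Suc[of 1] cos_th by simp
  have f: "f \<in> neil_algebra"
  proof -
    have "f holomorphic_on ball 0 1"
      unfolding f_def by (intro holomorphic_intros holomorphic_on_subset[OF g_hol]) auto
    moreover have "bounded (f ` ball 0 1)"
      unfolding bounded_iff using f_le by (intro exI[of _ 1]) auto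
    moreover have "deriv f 0 = 0"
      using fun_cong[OF f_coeff, of 1] b1 by (simp add: fps_expansion_def)
    ultimately show ?thesis
      by (simp add: neil_algebra_def H_inf_def)
  qed
  have norm_f: "H_inf_norm f \<le> 1"
    unfolding H_inf_norm_def using f_le by (intro cSUP_least) auto
  define E where "E = 1 - 2 * (s * r)\<^sup>2 * (1 - 2 * x0) - 8 * (s * r) ^ 3 * x0 * (1 - x0)"
  have b2: "b 2 = of_real (2 * s\<^sup>2 * (x0 + 2 * x0\<^sup>2 - 1))"
    using b_Suc[of 2] cos_double_cos[of "arccos x0"] unfolding cos_th by simp
  have b3: "b 3 = of_real (2 * s ^ 3 * (4 * x0 ^ 3 - 4 * x0))"
    using b_Suc[of 3] cos_treble_cos[of "arccos x0"] unfolding cos_th by simp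
  have "(\<Sum>n\<le>3. b n * of_real r ^ n) = b 0 + b 1 * of_real r + b 2 * of_real r ^ 2 + b 3 * of_real r ^ 3"
    by (simp add: numeral_eq_Suc)
  also have "\<dots> = of_real (1 + x0 + 2 * s\<^sup>2 * (x0 + 2 * x0\<^sup>2 - 1) * r\<^sup>2 + 2 * s ^ 3 * (4 * x0 ^ 3 - 4 * x0) * r ^ 3)"
    unfolding b0 b1 b2 b3 by simp
  \<comment> \<open>Both \<open>2 * x0\<^sup>2 + x0 - 1\<close> and \<open>x0 ^ 3 - x0\<close> are
    divisible by \<open>1 + x0\<close>.\<close>
  also have "1 + x0 + 2 * s\<^sup>2 * (x0 + 2 * x0\<^sup>2 - 1) * r\<^sup>2 + 2 * s ^ 3 * (4 * x0 ^ 3 - 4 * x0) * r ^ 3 = (1 + x0) * E"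
    unfolding E_def by (simp add: power2_eq_square power3_eq_cube algebra_simps)
  finally have b_sum: "(\<Sum>n\<le>3. b n * of_real r ^ n) = of_real ((1 + x0) * E)" .
  have "partial_sum 3 f (of_real r * 1)
      = (\<Sum>n\<le>3. (if n = 0 then 1 else 0) * of_real r ^ n) - \<epsilon> * (\<Sum>n\<le>3. b n * of_real r ^ n)"
    unfolding partial_sum_def f_coeff
    by (simp only: left_diff_distrib sum_subtractf sum_distrib_left mult.assoc mult_1_right)
  also have "(\<Sum>n\<le>3. (if n = 0 then 1 else 0) * of_real r ^ n) = (1 :: complex)"
    by (simp add: numeral_eq_Suc)
  also have "1 - \<epsilon> * (\<Sum>n\<le>3. b n * of_real r ^ n) = of_real (1 - \<epsilon> * (1 + x0) * E)"
    unfolding b_sum by simp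
  finally have "partial_sum 3 f (of_real r * 1) = of_real (1 - \<epsilon> * (1 + x0) * E)" .
  moreover have "\<epsilon> * (1 + x0) * E < 0"
    using \<epsilon> x0 neg by (intro mult_pos_neg) (auto simp: E_def)
  ultimately have "1 < cmod (partial_sum 3 f (of_real r * 1))"
    by (simp only: norm_of_real)
  also have "\<dots> \<le> (SUP z\<in>sphere 0 1. cmod (partial_sum 3 f (of_real r * z)))"
  proof (rule cSUP_upper)
    have "compact ((\<lambda>z. cmod (partial_sum 3 f (of_real r * z))) ` sphere 0 1)"
      unfolding partial_sum_def by (intro compact_continuous_image continuous_intros) auto
    then show "bdd_above ((\<lambda>z. cmod (partial_sum 3 f (of_real r * z))) ` sphere 0 1)"
      by (intro bounded_imp_bdd_above compact_imp_bounded)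
  qed simp
  finally show ?thesis
    using norm_f f by (intro bexI[of _ f]) auto
qed

text \<open>At radius \<open>r0\<close> the expression in \<open>neg\<close> equals
  \<open>- (4 * r0 ^ 3 + r0 - 2) / 2 = 0\<close>. It decreases strictly with the radius because
  \<open>0 < x0 < 1 / 2\<close>, so it is negative at every larger radius.\<close>

lemma r0_optimal:
  assumes "r > r0"
  shows "\<exists>f\<in>neil_algebra. (SUP z\<in>sphere 0 1. cmod (partial_sum 3 f (of_real r * z))) > H_inf_norm f"
proof -
  define x0 where "x0 = (2 * r0 - 1) / (4 * r0)"
  \<comment> \<open>An intermediate radius leaves room for the contraction
    \<open>s = t / r < 1\<close>.\<close>
  define t where "t = (r + r0) / 2"
  note b = r0_bounds
  have x0: "0 < x0" "x0 < 1 / 2" using b by (auto simp: x0_def field_simps)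
  have t: "r0 < t" "t < r" using assms by (auto simp: t_def)
  have eq: "1 - 2 * r0\<^sup>2 * (1 - 2 * x0) - 8 * r0 ^ 3 * x0 * (1 - x0) = 0"
  proof -
    have "4 * r0 * x0 = 2 * r0 - 1" "2 * r0 * (1 - 2 * x0) = 1" "4 * r0 * (1 - x0) = 2 * r0 + 1"
      using b by (simp_all add: x0_def field_simps)
    moreover have "1 - 2 * r0\<^sup>2 * (1 - 2 * x0) - 8 * r0 ^ 3 * x0 * (1 - x0)
        = 1 - r0 * (2 * r0 * (1 - 2 * x0)) - r0 * (4 * r0 * x0) * (4 * r0 * (1 - x0)) / 2"
      by (simp add: power2_eq_square power3_eq_cube)
    ultimately have "1 - 2 * r0\<^sup>2 * (1 - 2 * x0) - 8 * r0 ^ 3 * x0 * (1 - x0)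
        = 1 - r0 - r0 * (2 * r0 - 1) * (2 * r0 + 1) / 2" by simp
    also have "\<dots> = - (4 * r0 ^ 3 + r0 - 2) / 2"
      by (simp add: power3_eq_cube field_simps)
    finally show ?thesis using r0_root by simp
  qed
  have "r0\<^sup>2 < t\<^sup>2" "r0 ^ 3 < t ^ 3" using t b by (auto intro: power_strict_mono)
  then have "2 * r0\<^sup>2 * (1 - 2 * x0) < 2 * t\<^sup>2 * (1 - 2 * x0)"
    "8 * r0 ^ 3 * (x0 * (1 - x0)) < 8 * t ^ 3 * (x0 * (1 - x0))"
    using x0 by (auto intro!: mult_strict_right_mono mult_pos_pos)
  then have "1 - 2 * t\<^sup>2 * (1 - 2 * x0) - 8 * t ^ 3 * x0 * (1 - x0) < 0"
    using eq by (simp add: mult.assoc)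
  then show ?thesis
    using ex_partial_sum_3_large[of x0 "t / r" r] x0 t b by simp
qed

theorem theorem1p1:
  shows "(\<exists>!r::real. 4 * r ^ 3 + r - 2 = 0) \<and>
    (\<forall>f\<in>neil_algebra. \<forall>N\<ge>1.
       (SUP z\<in>sphere 0 1. cmod (partial_sum N f (complex_of_real r0 * z))) \<le> H_inf_norm f) \<and>
    (\<forall>r>r0. \<exists>f\<in>neil_algebra. \<exists>N\<ge>1.
       (SUP z\<in>sphere 0 1. cmod (partial_sum N f (complex_of_real r * z))) > H_inf_norm f)"
proof (intro conjI ballI allI impI)
  show "\<exists>!r::real. 4 * r ^ 3 + r - 2 = 0" by (rule ex1_r0)
next
  fix f and N :: nat
  assume f: "f \<in> neil_algebra" and "N \<ge> 1"
  then obtain c where "\<And>t. cos_poly N (\<lambda>k. if k = 1 then c else r0 ^ k) t \<ge> 0"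
    using ex_cos_poly_r0_nonneg by blast
  then show "(SUP z\<in>sphere 0 1. cmod (partial_sum N f (complex_of_real r0 * z))) \<le> H_inf_norm f"
    by (intro cSUP_least partial_sum_bound[OF f]) auto
next
  fix r assume "r > r0"
  from r0_optimal[OF this]
  show "\<exists>f\<in>neil_algebra. \<exists>N\<ge>1.
       (SUP z\<in>sphere 0 1. cmod (partial_sum N f (complex_of_real r * z))) > H_inf_norm f"
    by (metis one_le_numeral)
qed

end
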